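(* Let $(V,E)$ and $(W,F)$ be lattice-normed spaces with $V$ decomposable and $F$ Dedekind complete. Then every dominated Uryson operator $T:V\to W$ has an exact dominant $\|T\|$.
   Context: Lattice-normed spaces. Let $V$ be a real vector space and $E$ a real Archimedean vector lattice. A vector norm is a map $\|\cdot\|:V\to E$ with $\|v\|\ge 0$, $\|v\|=0\Leftrightarrow v=0$, $\|v_1+v_2\|\le\|v_1\|+\|v_2\|$, $\|\lambda v\|=|\lambda|\,\|v\|$ ($\lambda\in\mathbb{R}$). $(V,E)$ is then a lattice-normed space. It is decomposable if whenever $\|x\|=e_1+e_2$ with $e_1,e_2\in E_+$ there are $x_1,x_2\in V$ with $x=x_1+x_2$ and $\|x_k\|=e_k$ ($k=1,2$). Elements $x,y\in V$ are disjoint, $x\perp y$, if $\|x\|\wedge\|y\|=0$. Abstract Uryson operators. In a vector lattice, $x\perp y$ means $|x|\wedge|y|=0$. A map $S:E\to F$ between vector lattices is orthogonally additive if $S(x+y)=Sx+Sy$ whenever $x\perp y$; positive if $Sx\ge0$ for all $x\in E$; order bounded if it maps order bounded sets to order bounded sets; even if $S(x)=S(-x)$ for all $x$. An abstract Uryson operator is an orthogonally additive order bounded map. $\mathcal{U}_+^{ev}(E,F)$ is the set of positive even abstract Uryson operators, ordered by $S_1\le S_2$ iff $S_2-S_1$ is positive. Dominated Uryson operators. A map $T:V\to W$ is orthogonally additive if $T(u+v)=Tu+Tv$ whenever $u\perp v$ in $V$. It is a dominated Uryson operator if it is orthogonally additive and there is $S\in\mathcal{U}_+^{ev}(E,F)$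 with $\|Tv\|\le S\|v\|$ for all $v\in V$; such an $S$ is called a dominant of $T$. The exact dominant $\|T\|$ of $T$ is the least element, if it exists, of the set of all dominants of $T$ with respect to the order of $\mathcal{U}_+^{ev}(E,F)$. *)

theory Defs
  imports Complex_Main "HOL-Library.Lattice_Algebras"
begin

section \<open>Vector lattices\<close>

class vector_lattice = ordered_real_vector + lattice_ab_group_add_abs

class archimedean_vector_lattice = vector_lattice +
  assumes archimedean: "0 \<le> x \<Longrightarrow> (\<And>n::nat. real n *\<^sub>R x \<le> y) \<Longrightarrow> x = 0"

text \<open>Dedekind completeness is the library class \<^class>\<open>conditionally_complete_lattice\<close>:
  every nonempty set that is bounded above (below) has a supremum (infimum).\<close>

definition order_bounded :: "'a::order set \<Rightarrow> bool" where
  "order_bounded A \<longleftrightarrow> (\<exists>a b. A \<subseteq> {a..b})"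

definition lattice_disjoint :: "'e::vector_lattice \<Rightarrow> 'e \<Rightarrow> bool" where
  "lattice_disjoint x y \<longleftrightarrow> inf \<bar>x\<bar> \<bar>y\<bar> = 0"


section \<open>Abstract Uryson operators\<close>

definition orthogonally_additive :: "('e::vector_lattice \<Rightarrow> 'f::vector_lattice) \<Rightarrow> bool" where
  "orthogonally_additive S \<longleftrightarrow> (\<forall>x y. lattice_disjoint x y \<longrightarrow> S (x + y) = S x + S y)"

definition order_bounded_map :: "('e::vector_lattice \<Rightarrow> 'f::vector_lattice) \<Rightarrow> bool" where
  "order_bounded_map S \<longleftrightarrow> (\<forall>A. order_bounded A \<longrightarrow> order_bounded (S ` A))"

definition abstract_uryson :: "('e::vector_lattice \<Rightarrow> 'f::vector_lattice) \<Rightarrow> bool" where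
  "abstract_uryson S \<longleftrightarrow> orthogonally_additive S \<and> order_bounded_map S"

text \<open>Positivity refers to all arguments, not only to the positive ones as for linear operators.\<close>

definition positive_map :: "('e::vector_lattice \<Rightarrow> 'f::vector_lattice) \<Rightarrow> bool" where
  "positive_map S \<longleftrightarrow> (\<forall>x. 0 \<le> S x)"

definition even_map :: "('e::vector_lattice \<Rightarrow> 'f::vector_lattice) \<Rightarrow> bool" where
  "even_map S \<longleftrightarrow> (\<forall>x. S x = S (- x))"

definition positive_even_uryson :: "('e::vector_lattice \<Rightarrow> 'f::vector_lattice) set" where
  "positive_even_uryson = {S. abstract_uryson S \<and> positive_map S \<and> even_map S}"

definition uryson_le :: "('e::vector_lattice \<Rightarrow> 'f::vector_lattice) \<Rightarrow> ('e \<Rightarrow> 'f) \<Rightarrow> bool" where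
  "uryson_le S1 S2 \<longleftrightarrow> positive_map (\<lambda>x. S2 x - S1 x)"


section \<open>Lattice-normed spaces\<close>

definition lattice_normed_space :: "('v::real_vector \<Rightarrow> 'e::archimedean_vector_lattice) \<Rightarrow> bool" where
  "lattice_normed_space N \<longleftrightarrow>
     (\<forall>v. 0 \<le> N v) \<and>
     (\<forall>v. N v = 0 \<longleftrightarrow> v = 0) \<and>
     (\<forall>u v. N (u + v) \<le> N u + N v) \<and>
     (\<forall>c v. N (c *\<^sub>R v) = \<bar>c\<bar> *\<^sub>R N v)"

definition decomposable :: "('v::real_vector \<Rightarrow> 'e::archimedean_vector_lattice) \<Rightarrow> bool" where
  "decomposable N \<longleftrightarrow>
     (\<forall>x e1 e2. 0 \<le> e1 \<longrightarrow> 0 \<le> e2 \<longrightarrow> N x = e1 + e2 \<longrightarrow>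
        (\<exists>x1 x2. x = x1 + x2 \<and> N x1 = e1 \<and> N x2 = e2))"

definition norm_disjoint ::
    "('v::real_vector \<Rightarrow> 'e::archimedean_vector_lattice) \<Rightarrow> 'v \<Rightarrow> 'v \<Rightarrow> bool" where
  "norm_disjoint N x y \<longleftrightarrow> inf (N x) (N y) = 0"


section \<open>Dominated Uryson operators\<close>

text \<open>Below, \<open>NV\<close> and \<open>NW\<close> are the vector norms of \<open>V\<close> and \<open>W\<close>.\<close>

definition norm_orthogonally_additive ::
    "('v::real_vector \<Rightarrow> 'e::archimedean_vector_lattice) \<Rightarrow> ('v \<Rightarrow> 'w::real_vector) \<Rightarrow> bool" where
  "norm_orthogonally_additive NV T \<longleftrightarrow>
     (\<forall>u v. norm_disjoint NV u v \<longrightarrow> T (u + v) = T u + T v)"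

definition dominants ::
    "('v::real_vector \<Rightarrow> 'e::archimedean_vector_lattice) \<Rightarrow>
     ('w::real_vector \<Rightarrow> 'f::archimedean_vector_lattice) \<Rightarrow> ('v \<Rightarrow> 'w) \<Rightarrow> ('e \<Rightarrow> 'f) set" where
  "dominants NV NW T = {S \<in> positive_even_uryson. \<forall>v. NW (T v) \<le> S (NV v)}"

definition dominated_uryson ::
    "('v::real_vector \<Rightarrow> 'e::archimedean_vector_lattice) \<Rightarrow>
     ('w::real_vector \<Rightarrow> 'f::archimedean_vector_lattice) \<Rightarrow> ('v \<Rightarrow> 'w) \<Rightarrow> bool" where
  "dominated_uryson NV NW T \<longleftrightarrow>
     norm_orthogonally_additive NV T \<and> (\<exists>S. S \<in> dominants NV NW T)"

definition is_exact_dominant ::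
    "('v::real_vector \<Rightarrow> 'e::archimedean_vector_lattice) \<Rightarrow>
     ('w::real_vector \<Rightarrow> 'f::archimedean_vector_lattice) \<Rightarrow> ('v \<Rightarrow> 'w) \<Rightarrow> ('e \<Rightarrow> 'f) \<Rightarrow> bool" where
  "is_exact_dominant NV NW T S \<longleftrightarrow>
     S \<in> dominants NV NW T \<and> (\<forall>S' \<in> dominants NV NW T. uryson_le S S')"

end

theory Submission
  imports Defs
begin

text \<open>
  The exact dominant is a total variation. An even orthogonally additive map takes the same value at
  \<open>e\<close> and at \<open>\<bar>e\<bar>\<close>, so only positive arguments matter. For \<open>e \<ge> 0\<close> consider all finite families
  \<open>v\<^sub>1, \<dots>, v\<^sub>n\<close> in \<open>V\<close> with pairwise disjoint norms whose sum is a fragment of \<open>e\<close>, and call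
  \<open>\<parallel>T v\<^sub>1\<parallel> + \<dots> + \<parallel>T v\<^sub>n\<parallel>\<close> a variation sum of \<open>T\<close> below \<open>e\<close>. A dominant \<open>S\<close> is positive and
  additive on disjoint elements, so it bounds every variation sum below \<open>e\<close> by \<open>S e\<close>. As \<open>F\<close> is
  Dedekind complete, the supremum \<open>\<tau> e\<close> of these sums exists, and \<open>\<tau>\<close> lies below every dominant.

  What remains is that \<open>\<tau>\<close> (extended by \<open>\<tau> e = \<tau> \<bar>e\<bar>\<close>) is itself a dominant. It dominates \<open>T\<close>
  because \<open>\<parallel>T v\<parallel>\<close> is a variation sum below \<open>\<parallel>v\<parallel>\<close>, and it is order bounded because it lies between
  \<open>0\<close> and some dominant. The point is orthogonal additivity. If \<open>e\<close> and \<open>f\<close> are disjoint, families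
  below \<open>e\<close> and below \<open>f\<close> can be joined, which makes \<open>\<tau>\<close> superadditive
  (\<open>variation_sum_join\<close>). Conversely each member \<open>v\<close> of a family below \<open>e + f\<close> has
  \<open>\<parallel>v\<parallel> = \<parallel>v\<parallel> \<sqinter> e + \<parallel>v\<parallel> \<sqinter> f\<close>; decomposability splits \<open>v\<close> accordingly into two disjoint parts,
  \<open>T\<close> is additive on them, and the triangle inequality in \<open>W\<close> bounds the variation sum by one below
  \<open>e\<close> plus one below \<open>f\<close> (\<open>variation_sum_split\<close>).
\<close>

section \<open>Disjointness in vector lattices\<close>

lemma inf_mono_zero:
  fixes x y a b :: "'e::vector_lattice"
  assumes "inf x y = 0" "0 \<le> a" "a \<le> x" "0 \<le> b" "b \<le> y"
  shows "inf a b = 0"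
proof (rule antisym)
  show "inf a b \<le> 0"
    using inf_mono[OF assms(3,5)] assms(1) by simp
  show "0 \<le> inf a b"
    using assms by simp
qed

lemma disjoint_add_eq_sup:
  fixes x y :: "'e::vector_lattice"
  assumes "inf x y = 0"
  shows "x + y = sup x y"
  using add_eq_inf_sup[of x y] assms by simp

lemma inf_add_le:
  fixes x y z :: "'e::vector_lattice"
  assumes "0 \<le> x" "0 \<le> y" "0 \<le> z"
  shows "inf (x + y) z \<le> inf x z + inf y z"
proof -
  have "inf (x + y) z - inf y z \<le> inf x z"
  proof (rule inf_greatest)
    have "inf (x + y) z \<le> x + inf y z"
      using assms by (simp add: add_inf_distrib_left le_infI2 add_increasing)
    then show "inf (x + y) z - inf y z \<le> x"
      by (simp only: diff_le_eq)
    have "inf (x + y) z \<le> z + inf y z"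
      using assms by (intro le_infI2 add_increasing2) auto
    then show "inf (x + y) z - inf y z \<le> z"
      by (simp only: diff_le_eq)
  qed
  then show ?thesis
    by (simp only: diff_le_eq)
qed

lemma inf_disjoint_add:
  fixes x y z :: "'e::vector_lattice"
  assumes "inf x y = 0" "0 \<le> x" "0 \<le> y" "0 \<le> z"
  shows "inf (x + y) z = inf x z + inf y z"
proof (rule antisym)
  show "inf (x + y) z \<le> inf x z + inf y z"
    using assms by (intro inf_add_le)
  have "inf (inf x z) (inf y z) = 0"
    by (rule inf_mono_zero[OF assms(1)]) (use assms in auto)
  then have "inf x z + inf y z = sup (inf x z) (inf y z)"
    by (rule disjoint_add_eq_sup)
  moreover have "inf x z + inf y z \<le> x + y"
    by (intro add_mono) auto
  ultimately show "inf x z + inf y z \<le> inf (x + y) z"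
    by simp
qed

lemma disjoint_add_right:
  fixes x y z :: "'e::vector_lattice"
  assumes "inf x y = 0" "inf x z = 0" "0 \<le> x" "0 \<le> y" "0 \<le> z"
  shows "inf x (y + z) = 0"
proof (rule antisym)
  show "inf x (y + z) \<le> 0"
    using inf_add_le[of y z x] assms by (simp add: inf_commute)
  show "0 \<le> inf x (y + z)"
    using assms by simp
qed

lemma lattice_disjoint_pos_iff:
  fixes x y :: "'e::vector_lattice"
  assumes "0 \<le> x" "0 \<le> y"
  shows "lattice_disjoint x y \<longleftrightarrow> inf x y = 0"
  using assms by (simp add: lattice_disjoint_def)

lemma le_abs_diff_of_disjoint:
  fixes a b :: "'e::vector_lattice"
  assumes "inf a b = 0"
  shows "a \<le> \<bar>a - b\<bar>"
proof -
  have "a - \<bar>a - b\<bar> \<le> a"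
    by (simp add: diff_le_eq)
  moreover have "a - \<bar>a - b\<bar> \<le> b"
    using abs_ge_self[of "a - b"] by (simp add: algebra_simps)
  ultimately have "a - \<bar>a - b\<bar> \<le> inf a b"
    by simp
  with assms show ?thesis
    by simp
qed

text \<open>The modulus is sandwiched between \<open>\<bar>\<bar>e\<bar> - \<bar>f\<bar>\<bar>\<close> and \<open>\<bar>e\<bar> + \<bar>f\<bar>\<close>, and for disjoint elements
  both bounds are equal to \<open>\<bar>e\<bar> \<squnion> \<bar>f\<bar>\<close>.\<close>

lemma abs_add_of_disjoint:
  fixes e f :: "'e::vector_lattice"
  assumes "lattice_disjoint e f"
  shows "\<bar>e + f\<bar> = \<bar>e\<bar> + \<bar>f\<bar>"
proof (rule antisym)
  show "\<bar>e + f\<bar> \<le> \<bar>e\<bar> + \<bar>f\<bar>"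
    by (rule abs_triangle_ineq)
  have d: "inf \<bar>e\<bar> \<bar>f\<bar> = 0"
    using assms by (simp add: lattice_disjoint_def)
  have "\<bar>e\<bar> + \<bar>f\<bar> = sup \<bar>e\<bar> \<bar>f\<bar>"
    using d by (rule disjoint_add_eq_sup)
  also have "\<dots> \<le> \<bar>\<bar>e\<bar> - \<bar>f\<bar>\<bar>"
    using le_abs_diff_of_disjoint[OF d] le_abs_diff_of_disjoint[of "\<bar>f\<bar>" "\<bar>e\<bar>"] d
    by (simp add: inf_commute abs_minus_commute)
  also have "\<dots> \<le> \<bar>e + f\<bar>"
    using abs_triangle_ineq3[of e "- f"] by simp
  finally show "\<bar>e\<bar> + \<bar>f\<bar> \<le> \<bar>e + f\<bar>" .
qed

lemma pprt_nprt_disjoint: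
  fixes e :: "'e::vector_lattice"
  shows "inf (pprt e) (- nprt e) = 0"
proof -
  have "- nprt e = pprt e - e"
    using prts[of e] by (simp add: algebra_simps)
  then have "inf (pprt e) (- nprt e) = pprt e + inf 0 (- e)"
    by (simp add: add_inf_distrib_left)
  also have "inf 0 (- e) = - pprt e"
    by (simp add: pprt_def neg_sup_eq_inf inf_commute)
  finally show ?thesis
    by simp
qed

text \<open>Split \<open>e\<close> into its disjoint positive and negative parts; evenness lets the sign of the
  negative part be changed, which turns \<open>e\<close> into \<open>\<bar>e\<bar>\<close>.\<close>

lemma even_orthogonally_additive_abs:
  assumes oa: "orthogonally_additive S" and ev: "even_map S"
  shows "S \<bar>e\<bar> = S e"
proof -
  have p: "\<bar>pprt e\<bar> = pprt e" and n: "\<bar>nprt e\<bar> = - nprt e"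
    by simp_all
  have "lattice_disjoint (pprt e) (nprt e)" "lattice_disjoint (pprt e) (- nprt e)"
    unfolding lattice_disjoint_def using pprt_nprt_disjoint[of e] p n by simp_all
  then have "S (pprt e + nprt e) = S (pprt e) + S (nprt e)"
    and "S (pprt e + - nprt e) = S (pprt e) + S (- nprt e)"
    using oa unfolding orthogonally_additive_def by blast+
  moreover have "S (- nprt e) = S (nprt e)"
    using ev unfolding even_map_def by metis
  ultimately show ?thesis
    by (simp add: prts[symmetric] abs_prts)
qed


section \<open>Variation sums\<close>

text \<open>\<open>variation_sum NV NW T e t\<close> holds iff \<open>t = \<parallel>T v\<^sub>1\<parallel> + \<dots> + \<parallel>T v\<^sub>n\<parallel>\<close> for a finite
  family with pairwise disjoint norms whose sum is a fragment of \<open>e \<ge> 0\<close>. The rule \<open>base\<close> starts with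
  the part of \<open>e\<close> that the family leaves uncovered. Demanding that the norms cover
  \<open>e\<close> would be too strong, since not every positive element is a norm and there might be no family
  at all.\<close>

inductive variation_sum ::
    "('v::real_vector \<Rightarrow> 'e::archimedean_vector_lattice) \<Rightarrow>
     ('w::real_vector \<Rightarrow> 'f::archimedean_vector_lattice) \<Rightarrow> ('v \<Rightarrow> 'w) \<Rightarrow> 'e \<Rightarrow> 'f \<Rightarrow> bool"
  for NV NW T where
    base: "0 \<le> e \<Longrightarrow> variation_sum NV NW T e 0"
  | step: "variation_sum NV NW T e t \<Longrightarrow> inf e (NV v) = 0 \<Longrightarrow>
      variation_sum NV NW T (e + NV v) (t + NW (T v))"

text \<open>A dominant can be evaluated along the family: it is additive on the disjoint norms, bounds each
  summand, and is nonnegative on the uncovered part.\<close>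

lemma variation_sum_le_dominant:
  assumes "variation_sum NV NW T e t"
    and N: "lattice_normed_space NV" and S: "S \<in> dominants NV NW T"
  shows "0 \<le> e \<and> t \<le> S e"
  using assms(1)
proof induction
  case (base e)
  then show ?case
    using S by (simp add: dominants_def positive_even_uryson_def positive_map_def)
next
  case (step e t v)
  have v: "0 \<le> NV v"
    using N by (simp add: lattice_normed_space_def)
  then have "lattice_disjoint e (NV v)"
    using step by (simp add: lattice_disjoint_pos_iff)
  then have "S (e + NV v) = S e + S (NV v)"
    using S by (simp add: dominants_def positive_even_uryson_def abstract_uryson_def
        orthogonally_additive_def)
  moreover have "NW (T v) \<le> S (NV v)"
    using S by (simp add: dominants_def)
  ultimately show ?case
    using step v by (simp add: add_mono)
qed

lemma variation_sum_nonneg: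
  assumes "variation_sum NV NW T e t" and N: "lattice_normed_space NV"
  shows "0 \<le> e"
  using assms(1) by induction (use N in \<open>auto simp: lattice_normed_space_def\<close>)

lemma variation_sum_enlarge:
  assumes "variation_sum NV NW T e t" and N: "lattice_normed_space NV"
    and "0 \<le> f" "inf e f = 0"
  shows "variation_sum NV NW T (e + f) t"
  using assms(1,3,4)
proof induction
  case (base e)
  then show ?case
    by (intro variation_sum.base) simp
next
  case (step e t v)
  have e: "0 \<le> e" and v: "0 \<le> NV v"
    using variation_sum_nonneg[OF step(1) N] N by (simp_all add: lattice_normed_space_def)
  have ef: "inf e f = 0" and vf: "inf (NV v) f = 0"
    using inf_mono_zero[OF step.prems(2)] e v step.prems(1) by simp_all
  have "inf (NV v) (e + f) = 0"
    using e v vf step by (intro disjoint_add_right) (simp_all add: inf_commute)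
  then have "variation_sum NV NW T (e + f + NV v) (t + NW (T v))"
    using step ef by (intro variation_sum.step) (simp_all add: inf_commute)
  then show ?case
    by (simp add: algebra_simps)
qed

lemma variation_sum_join:
  assumes "variation_sum NV NW T f s" and N: "lattice_normed_space NV"
    and e: "variation_sum NV NW T e t" and "inf e f = 0"
  shows "variation_sum NV NW T (e + f) (t + s)"
  using assms(1,4)
proof induction
  case (base f)
  then show ?case
    using variation_sum_enlarge[OF e N] by simp
next
  case (step f s v)
  have e0: "0 \<le> e" and f: "0 \<le> f" and v: "0 \<le> NV v"
    using variation_sum_nonneg[OF e N] variation_sum_nonneg[OF step(1) N] N
    by (simp_all add: lattice_normed_space_def)
  have ef: "inf e f = 0" and ev: "inf e (NV v) = 0"
    using inf_mono_zero[OF step.prems] e0 f v by simp_all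
  have "inf (NV v) (e + f) = 0"
    using e0 f v ev step by (intro disjoint_add_right) (simp_all add: inf_commute)
  then have "variation_sum NV NW T (e + f + NV v) (t + s + NW (T v))"
    using step ef by (intro variation_sum.step) (simp_all add: inf_commute)
  then show ?case
    by (simp add: algebra_simps)
qed

text \<open>This is where decomposability enters. If \<open>g + \<parallel>v\<parallel> = e + f\<close> with both sums disjoint, the four
  infima of a summand on the left and a summand on the right form a common refinement of the two
  decompositions, and \<open>v\<close> is cut along it.\<close>

lemma variation_sum_split:
  assumes "variation_sum NV NW T p r"
    and N: "lattice_normed_space NV" and M: "lattice_normed_space NW"
    and dec: "decomposable NV" and T: "norm_orthogonally_additive NV T"
    and "p = e + f" "inf e f = 0" "0 \<le> e" "0 \<le> f"
  shows "\<exists>t s. variation_sum NV NW T e t \<and> variation_sum NV NW T f s \<and> r \<le> t + s"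
  using assms(1,6-9)
proof (induction arbitrary: e f)
  case (base p)
  then show ?case
    using variation_sum.base[of e NV NW T] variation_sum.base[of f NV NW T] by fastforce
next
  case (step g r v)
  let ?n = "NV v"
  have g: "0 \<le> g" and n: "0 \<le> ?n"
    using variation_sum_nonneg[OF step(1) N] N by (simp_all add: lattice_normed_space_def)
  have left: "g \<le> e + f" "?n \<le> e + f" and right: "e \<le> g + ?n" "f \<le> g + ?n"
    using step.prems g n by (metis add_increasing add_increasing2 order_refl)+
  \<comment> \<open>The four pieces of the common refinement: they add up to \<open>g\<close> and \<open>\<parallel>v\<parallel>\<close> in one direction and
    to \<open>e\<close> and \<open>f\<close> in the other.\<close>
  have g_eq: "g = inf e g + inf f g" and n_eq: "?n = inf e ?n + inf f ?n"
    using inf_disjoint_add[OF step.prems(2-4) g] inf_disjoint_add[OF step.prems(2-4) n] left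
    by (simp_all add: inf_absorb2)
  have e_eq: "e = inf e g + inf e ?n" and f_eq: "f = inf f g + inf f ?n"
    using inf_disjoint_add[OF step(2) g n step.prems(3)]
      inf_disjoint_add[OF step(2) g n step.prems(4)] right
    by (simp_all only: inf_absorb2 inf_commute[of _ g] inf_commute[of _ ?n])
  have pos: "0 \<le> inf e g" "0 \<le> inf f g" "0 \<le> inf e ?n" "0 \<le> inf f ?n"
    using step.prems g n by simp_all
  have "inf (inf e g) (inf f g) = 0"
    using inf_mono_zero[OF step.prems(2)] pos by simp
  then obtain t s where t: "variation_sum NV NW T (inf e g) t"
    and s: "variation_sum NV NW T (inf f g) s" and r: "r \<le> t + s"
    using step.IH[OF g_eq] pos by blast
  obtain v1 v2 where v12: "v = v1 + v2" and v1: "NV v1 = inf e ?n" and v2: "NV v2 = inf f ?n"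
    using dec pos(3,4) n_eq unfolding decomposable_def by metis
  have "variation_sum NV NW T (inf e g + NV v1) (t + NW (T v1))"
    using t inf_mono_zero[OF step(2)] pos v1 by (intro variation_sum.step) simp_all
  then have t': "variation_sum NV NW T e (t + NW (T v1))"
    using e_eq v1 by simp
  have "variation_sum NV NW T (inf f g + NV v2) (s + NW (T v2))"
    using s inf_mono_zero[OF step(2)] pos v2 by (intro variation_sum.step) simp_all
  then have s': "variation_sum NV NW T f (s + NW (T v2))"
    using f_eq v2 by simp
  have "norm_disjoint NV v1 v2"
    unfolding norm_disjoint_def v1 v2
    using inf_mono_zero[OF step.prems(2)] pos by simp
  then have "T v = T v1 + T v2"
    using T v12 by (simp add: norm_orthogonally_additive_def)
  then have "NW (T v) \<le> NW (T v1) + NW (T v2)"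
    using M by (simp add: lattice_normed_space_def)
  with r have "r + NW (T v) \<le> (t + s) + (NW (T v1) + NW (T v2))"
    by (rule add_mono)
  then have "r + NW (T v) \<le> (t + NW (T v1)) + (s + NW (T v2))"
    by (simp add: algebra_simps)
  with t' s' show ?case
    by blast
qed


section \<open>The total variation is the exact dominant\<close>

definition total_variation ::
    "('v::real_vector \<Rightarrow> 'e::archimedean_vector_lattice) \<Rightarrow>
     ('w::real_vector \<Rightarrow> 'f::{archimedean_vector_lattice, conditionally_complete_lattice}) \<Rightarrow>
     ('v \<Rightarrow> 'w) \<Rightarrow> 'e \<Rightarrow> 'f" where
  "total_variation NV NW T e = Sup {t. variation_sum NV NW T \<bar>e\<bar> t}"

lemma variation_sum_le_total_variation:
  assumes "lattice_normed_space NV" "S \<in> dominants NV NW T" "variation_sum NV NW T \<bar>e\<bar> t"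
  shows "t \<le> total_variation NV NW T e"
  unfolding total_variation_def
proof (rule cSup_upper)
  show "t \<in> {t. variation_sum NV NW T \<bar>e\<bar> t}"
    using assms by simp
  show "bdd_above {t. variation_sum NV NW T \<bar>e\<bar> t}"
    using variation_sum_le_dominant[OF _ assms(1,2)] by (intro bdd_aboveI) blast
qed

lemma total_variation_least:
  assumes "\<And>t. variation_sum NV NW T \<bar>e\<bar> t \<Longrightarrow> t \<le> b"
  shows "total_variation NV NW T e \<le> b"
  unfolding total_variation_def
  using variation_sum.base[of "\<bar>e\<bar>" NV NW T] assms by (intro cSup_least) auto

lemma total_variation_nonneg:
  assumes "lattice_normed_space NV" "S \<in> dominants NV NW T"
  shows "0 \<le> total_variation NV NW T e"
  using assms by (intro variation_sum_le_total_variation variation_sum.base) auto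

lemma total_variation_le_dominant:
  assumes "lattice_normed_space NV" "S \<in> dominants NV NW T"
  shows "total_variation NV NW T e \<le> S e"
proof (rule total_variation_least)
  fix t
  assume "variation_sum NV NW T \<bar>e\<bar> t"
  then have "t \<le> S \<bar>e\<bar>"
    using variation_sum_le_dominant assms by blast
  also have "S \<bar>e\<bar> = S e"
    using assms(2) even_orthogonally_additive_abs
    by (auto simp: dominants_def positive_even_uryson_def abstract_uryson_def)
  finally show "t \<le> S e" .
qed

lemma total_variation_orthogonally_additive:
  assumes N: "lattice_normed_space NV" and M: "lattice_normed_space NW"
    and dec: "decomposable NV" and T: "norm_orthogonally_additive NV T"
    and S: "S \<in> dominants NV NW T"
  shows "orthogonally_additive (total_variation NV NW T)"
  unfolding orthogonally_additive_def
proof (intro allI impI)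
  fix e f :: 'b
  assume "lattice_disjoint e f"
  then have abs_eq: "\<bar>e + f\<bar> = \<bar>e\<bar> + \<bar>f\<bar>" and d: "inf \<bar>e\<bar> \<bar>f\<bar> = 0"
    by (simp_all add: abs_add_of_disjoint lattice_disjoint_def)
  let ?V = "total_variation NV NW T"
  show "?V (e + f) = ?V e + ?V f"
  proof (rule antisym)
    show "?V (e + f) \<le> ?V e + ?V f"
    proof (rule total_variation_least)
      fix r
      assume "variation_sum NV NW T \<bar>e + f\<bar> r"
      then obtain t s where "variation_sum NV NW T \<bar>e\<bar> t" "variation_sum NV NW T \<bar>f\<bar> s"
        and r: "r \<le> t + s"
        using variation_sum_split[OF _ N M dec T abs_eq d abs_ge_zero abs_ge_zero] by blast
      then have "t + s \<le> ?V e + ?V f"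
        using variation_sum_le_total_variation[OF N S] by (intro add_mono)
      with r show "r \<le> ?V e + ?V f"
        by (rule order_trans)
    qed
    have sum_le: "t + s \<le> ?V (e + f)"
      if "variation_sum NV NW T \<bar>e\<bar> t" "variation_sum NV NW T \<bar>f\<bar> s" for t s
      using variation_sum_join[OF that(2) N that(1) d] abs_eq
      by (intro variation_sum_le_total_variation[OF N S]) simp
    have "?V e \<le> ?V (e + f) - ?V f"
    proof (rule total_variation_least)
      fix t
      assume t: "variation_sum NV NW T \<bar>e\<bar> t"
      have "?V f \<le> ?V (e + f) - t"
        using sum_le[OF t] by (intro total_variation_least) (simp add: le_diff_eq add.commute)
      then show "t \<le> ?V (e + f) - ?V f"
        by (simp add: le_diff_eq add.commute)
    qed
    then show "?V e + ?V f \<le> ?V (e + f)"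
      by (simp add: le_diff_eq)
  qed
qed

lemma order_bounded_map_le:
  assumes "order_bounded_map S" "\<And>x. 0 \<le> R x" "\<And>x. R x \<le> S x"
  shows "order_bounded_map R"
  unfolding order_bounded_map_def
proof (intro allI impI)
  fix A :: "'a set"
  assume "order_bounded A"
  then obtain a b where "S ` A \<subseteq> {a..b}"
    using assms(1) unfolding order_bounded_map_def order_bounded_def by blast
  then have "S x \<le> b" if "x \<in> A" for x
    using that by auto
  then have "R ` A \<subseteq> {0..b}"
    using assms(2) order_trans[OF assms(3)] by auto
  then show "order_bounded (R ` A)"
    unfolding order_bounded_def by blast
qed

lemma norm_le_total_variation:
  assumes N: "lattice_normed_space NV" and S: "S \<in> dominants NV NW T"
  shows "NW (T v) \<le> total_variation NV NW T (NV v)"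
proof -
  have v: "0 \<le> NV v"
    using N by (simp add: lattice_normed_space_def)
  have "variation_sum NV NW T (0 + NV v) (0 + NW (T v))"
    using v by (intro variation_sum.step variation_sum.base) (simp_all add: inf_absorb1)
  with v show ?thesis
    by (intro variation_sum_le_total_variation[OF N S]) simp
qed

theorem theorem4p4:
  fixes NV :: "'v::real_vector \<Rightarrow> 'e::archimedean_vector_lattice"
    and NW :: "'w::real_vector \<Rightarrow> 'f::{archimedean_vector_lattice, conditionally_complete_lattice}"
    and T :: "'v \<Rightarrow> 'w"
  assumes "lattice_normed_space NV"
    and "lattice_normed_space NW"
    and "decomposable NV"
    and "dominated_uryson NV NW T"
  shows "\<exists>S. is_exact_dominant NV NW T S"
proof -
  obtain S where T: "norm_orthogonally_additive NV T" and S: "S \<in> dominants NV NW T"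
    using assms(4) unfolding dominated_uryson_def by blast
  let ?V = "total_variation NV NW T"
  have "order_bounded_map S"
    using S by (simp add: dominants_def positive_even_uryson_def abstract_uryson_def)
  then have "order_bounded_map ?V"
    using total_variation_nonneg[OF assms(1) S] total_variation_le_dominant[OF assms(1) S]
    by (rule order_bounded_map_le)
  moreover have "orthogonally_additive ?V"
    using assms(1-3) T S by (rule total_variation_orthogonally_additive)
  moreover have "positive_map ?V"
    using total_variation_nonneg[OF assms(1) S] by (simp add: positive_map_def)
  moreover have "even_map ?V"
    by (simp add: even_map_def total_variation_def)
  ultimately have "?V \<in> dominants NV NW T"
    using norm_le_total_variation[OF assms(1) S]
    by (simp add: dominants_def positive_even_uryson_def abstract_uryson_def)
  moreover have "uryson_le ?V S'" if "S' \<in> dominants NV NW T" for S'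
    using total_variation_le_dominant[OF assms(1) that]
    by (simp add: uryson_le_def positive_map_def)
  ultimately show ?thesis
    unfolding is_exact_dominant_def by blast
qed

end
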